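(* For every $d\in\mathbb{N}$, there is a deterministic protocol for $\mathrm{Sp}_{d,n}^{d-1}$ with $O(\log^2 n)$ bits of communication.
   Context: Let $\Delta=\mathrm{conv}(v_0,\ldots,v_d)$ be the unit $d$-simplex and let $T$ be a triangulation of $\Delta$ with $n$ points (vertices). A coloring $c:T\to\{0,\ldots,d\}$ is a Sperner-coloring if $c(v_i)=i$ for all $i\in\{0,\ldots,d\}$ and every $x\in T$ gets the color of one of the vertices of the smallest face of $\Delta$ containing $x$. A $d$-simplex of the triangulation is panchromatic if its $d+1$ vertices receive all $d+1$ colors. The Concatenation Sperner problem $\mathrm{Sp}_{d,n}^t$ (for $t\le d<n$) is the two-player communication problem in which the triangulation $T$ (with points labeled by $[n]$) is publicly known, player $A$ is given a set $S_A\subset T$ and a coloring $c_A:S_A\to\{0,\ldots,t-1\}$ (i.e., the color classes of the first $t$ colors), and player $B$ is given a set $S_B\subset T$ and a coloring $c_B:S_B\to\{t,\ldots,d\}$ (the remaining color classes). Their goal is to output a panchromatic $d$-simplex of the triangulation, or to exhibit a point showing that the assumptions fail (e.g., that $S_A\dot\cup S_B=T$ does not hold, or that the combined coloring is not a Sperner-coloring). *)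

theory Defs
  imports "HOL-Analysis.Analysis" "HOL-Library.Landau_Symbols"
begin

text \<open>
  Protocol trees: at every inner node the owner announces one bit computed from their own input
  (the bits announced so far are encoded by the position in the tree), and the answer is read off
  from the leaf, so that it is known to both players.
\<close>

datatype ('x, 'y, 'z) protocol =
    Answer 'z
  | Ask_A "'x \<Rightarrow> bool" "('x, 'y, 'z) protocol" "('x, 'y, 'z) protocol"
  | Ask_B "'y \<Rightarrow> bool" "('x, 'y, 'z) protocol" "('x, 'y, 'z) protocol"

primrec run :: "('x, 'y, 'z) protocol \<Rightarrow> 'x \<Rightarrow> 'y \<Rightarrow> 'z" where
  "run (Answer z) x y = z"
| "run (Ask_A q P Q) x y = (if q x then run P x y else run Q x y)"
| "run (Ask_B q P Q) x y = (if q y then run P x y else run Q x y)"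

primrec cost :: "('x, 'y, 'z) protocol \<Rightarrow> nat" where
  "cost (Answer z) = 0"
| "cost (Ask_A q P Q) = Suc (max (cost P) (cost Q))"
| "cost (Ask_B q P Q) = Suc (max (cost P) (cost Q))"

definition solves ::
  "('x, 'y, 'z) protocol \<Rightarrow> 'x set \<Rightarrow> 'y set \<Rightarrow> ('x \<Rightarrow> 'y \<Rightarrow> 'z \<Rightarrow> bool) \<Rightarrow> bool" where
  "solves P X Y R \<longleftrightarrow> (\<forall>x\<in>X. \<forall>y\<in>Y. R x y (run P x y))"

definition vertices :: "'a::euclidean_space set \<Rightarrow> 'a set" where
  "vertices S = {x. x extreme_point_of S}"

definition points :: "'a::euclidean_space set set \<Rightarrow> 'a set" where
  "points K = (\<Union>S\<in>K. vertices S)"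

definition nondegenerate :: "nat \<Rightarrow> (nat \<Rightarrow> 'a::euclidean_space) \<Rightarrow> bool" where
  "nondegenerate d v \<longleftrightarrow> inj_on v {..d} \<and> \<not> affine_dependent (v ` {..d})"

definition big_simplex :: "nat \<Rightarrow> (nat \<Rightarrow> 'a::euclidean_space) \<Rightarrow> 'a set" where
  "big_simplex d v = convex hull (v ` {..d})"

definition triangulates :: "'a::euclidean_space set set \<Rightarrow> 'a set \<Rightarrow> bool" where
  "triangulates K D \<longleftrightarrow> simplicial_complex K \<and> \<Union>K = D"

definition smallest_face :: "'a::euclidean_space set \<Rightarrow> 'a \<Rightarrow> 'a set" where
  "smallest_face D x = \<Inter>{F. F face_of D \<and> x \<in> F}"

definition sperner_at :: "nat \<Rightarrow> (nat \<Rightarrow> 'a::euclidean_space) \<Rightarrow> 'a \<Rightarrow> nat \<Rightarrow> bool" where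
  "sperner_at d v x i \<longleftrightarrow>
     i \<le> d \<and> (\<forall>j\<le>d. x = v j \<longrightarrow> i = j) \<and> v i \<in> vertices (smallest_face (big_simplex d v) x)"

definition sperner_coloring ::
  "nat \<Rightarrow> (nat \<Rightarrow> 'a::euclidean_space) \<Rightarrow> 'a set set \<Rightarrow> ('a \<Rightarrow> nat) \<Rightarrow> bool" where
  "sperner_coloring d v K c \<longleftrightarrow> (\<forall>x\<in>points K. sperner_at d v x (c x))"

text \<open>
  A coloring of a set of points is a partial map, its domain being the colored set.
\<close>

definition inputs :: "'a::euclidean_space set set \<Rightarrow> nat set \<Rightarrow> ('a \<rightharpoonup> nat) set" where
  "inputs K C = {c. dom c \<subseteq> points K \<and> ran c \<subseteq> C}"

text \<open>
  The combined coloring is left undefined at points colored by both players.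
\<close>

definition combine :: "('a \<rightharpoonup> nat) \<Rightarrow> ('a \<rightharpoonup> nat) \<Rightarrow> ('a \<rightharpoonup> nat)" where
  "combine cA cB x = (case (cA x, cB x) of
       (Some i, None) \<Rightarrow> Some i
     | (None, Some i) \<Rightarrow> Some i
     | _ \<Rightarrow> None)"

datatype 'a answer = Panchromatic "'a set" | Violation 'a

fun sperner_answer ::
  "nat \<Rightarrow> (nat \<Rightarrow> 'a::euclidean_space) \<Rightarrow> 'a set set \<Rightarrow> ('a \<rightharpoonup> nat) \<Rightarrow> ('a \<rightharpoonup> nat) \<Rightarrow> 'a answer \<Rightarrow> bool"
where
  "sperner_answer d v K cA cB (Panchromatic S) \<longleftrightarrow>
     S \<in> K \<and> int d simplex S \<and> combine cA cB ` vertices S = Some ` {..d}"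
| "sperner_answer d v K cA cB (Violation x) \<longleftrightarrow>
     x \<in> points K \<and>
     (x \<notin> dom cA \<union> dom cB \<or> x \<in> dom cA \<inter> dom cB \<or>
      (\<exists>i. combine cA cB x = Some i \<and> \<not> sperner_at d v x i))"

lemma no_violation_iff:
  assumes "cA \<in> inputs K {..<t}" "cB \<in> inputs K {t..d}"
  shows "(\<nexists>x. sperner_answer d v K cA cB (Violation x)) \<longleftrightarrow>
    dom cA \<union> dom cB = points K \<and> dom cA \<inter> dom cB = {} \<and>
    sperner_coloring d v K (\<lambda>x. the (combine cA cB x))"
    (is "?L \<longleftrightarrow> ?R")
proof
  assume ?L
  then have nv: "x \<notin> dom cA \<inter> dom cB" "x \<in> dom cA \<union> dom cB"
    "combine cA cB x = Some i \<Longrightarrow> sperner_at d v x i" if "x \<in> points K" for x i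
    using that sperner_answer.simps(2) by blast+
  have sub: "dom cA \<subseteq> points K" "dom cB \<subseteq> points K"
    using assms unfolding inputs_def by blast+
  have 1: "dom cA \<union> dom cB = points K" "dom cA \<inter> dom cB = {}"
    using nv(1,2) sub by blast+
  have "sperner_at d v x (the (combine cA cB x))" if x: "x \<in> points K" for x
  proof -
    have "x \<in> dom cA \<longleftrightarrow> x \<notin> dom cB" using 1 x by blast
    then obtain i where i: "combine cA cB x = Some i"
      by (cases "cA x"; cases "cB x") (auto simp: combine_def)
    with nv(3)[OF x i] show ?thesis by simp
  qed
  with 1 show ?R by (simp add: sperner_coloring_def)
next
  assume ?R
  then have R: "dom cA \<union> dom cB = points K" "dom cA \<inter> dom cB = {}"
    "\<And>x. x \<in> points K \<Longrightarrow> sperner_at d v x (the (combine cA cB x))"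
    unfolding sperner_coloring_def by blast+
  show ?L
    unfolding sperner_answer.simps using R by (metis empty_iff option.sel)
qed

definition solves_Sp ::
  "nat \<Rightarrow> nat \<Rightarrow> (nat \<Rightarrow> 'a::euclidean_space) \<Rightarrow> 'a set set \<Rightarrow>
   ('a \<rightharpoonup> nat, 'a \<rightharpoonup> nat, 'a answer) protocol \<Rightarrow> bool" where
  "solves_Sp t d v K P \<longleftrightarrow>
     solves P (inputs K {..<t}) (inputs K {t..d}) (sperner_answer d v K)"

end

theory Submission
  imports Defs
begin

text \<open>
  Write \<open>d = Suc t\<close>, so that \<open>A\<close> knows the colors below \<open>t\<close> and \<open>B\<close> knows the colors \<open>t\<close> and \<open>d\<close>.
  Player \<open>A\<close> joins two points outside \<open>S\<^sub>A\<close> by an edge if they are the two remaining vertices of a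
  \<open>d\<close>-simplex showing all of \<open>A\<close>'s colors; such a simplex is panchromatic as soon as \<open>B\<close> colors
  the two points differently. By Sperner's lemma this graph contains a path from the facet opposite
  to \<open>v d\<close>, where \<open>B\<close> may only use \<open>t\<close>, to the facet opposite to \<open>v t\<close>, where \<open>B\<close> may only use \<open>d\<close>.
  Binary search for a color change along the path takes \<open>O(log n)\<close> rounds, in each of which \<open>A\<close>
  names a point with \<open>O(log n)\<close> bits and \<open>B\<close> answers with its color.
\<close>

subsection \<open>Protocols on promise sets\<close>

text \<open>
  The predicate \<open>D\<close> below records what has become known about the inputs at the current node.
\<close>

definition solvable_within ::
  "('x \<Rightarrow> 'y \<Rightarrow> 'z \<Rightarrow> bool) \<Rightarrow> nat \<Rightarrow> ('x \<Rightarrow> 'y \<Rightarrow> bool) \<Rightarrow> bool" where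
  "solvable_within R k D \<longleftrightarrow> (\<exists>P. cost P \<le> k \<and> (\<forall>x y. D x y \<longrightarrow> R x y (run P x y)))"

lemma solvable_within_mono:
  assumes "solvable_within R k D" "k \<le> k'" "\<And>x y. D' x y \<Longrightarrow> D x y"
  shows "solvable_within R k' D'"
  using assms unfolding solvable_within_def by (meson le_trans)

lemma solvable_within_answer:
  assumes "\<And>x y. D x y \<Longrightarrow> R x y z"
  shows "solvable_within R k D"
  unfolding solvable_within_def using assms by (intro exI[of _ "Answer z"]) auto

lemma solvable_within_ask_A:
  assumes "solvable_within R k (\<lambda>x y. D x y \<and> q x)" "solvable_within R k (\<lambda>x y. D x y \<and> \<not> q x)"
  shows "solvable_within R (Suc k) D"
proof -
  obtain P Q where "cost P \<le> k" "\<forall>x y. D x y \<and> q x \<longrightarrow> R x y (run P x y)"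
    "cost Q \<le> k" "\<forall>x y. D x y \<and> \<not> q x \<longrightarrow> R x y (run Q x y)"
    using assms unfolding solvable_within_def by blast
  then show ?thesis
    unfolding solvable_within_def by (intro exI[of _ "Ask_A q P Q"]) auto
qed

lemma solvable_within_ask_B:
  assumes "solvable_within R k (\<lambda>x y. D x y \<and> q y)" "solvable_within R k (\<lambda>x y. D x y \<and> \<not> q y)"
  shows "solvable_within R (Suc k) D"
proof -
  obtain P Q where "cost P \<le> k" "\<forall>x y. D x y \<and> q y \<longrightarrow> R x y (run P x y)"
    "cost Q \<le> k" "\<forall>x y. D x y \<and> \<not> q y \<longrightarrow> R x y (run Q x y)"
    using assms unfolding solvable_within_def by blast
  then show ?thesis
    unfolding solvable_within_def by (intro exI[of _ "Ask_B q P Q"]) auto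
qed

lemma halve_finite_set:
  assumes "finite Z" "card Z \<le> 2 ^ Suc k"
  obtains Z1 Z2 where "Z = Z1 \<union> Z2" "finite Z1" "finite Z2" "card Z1 \<le> 2 ^ k" "card Z2 \<le> 2 ^ k"
proof (cases "card Z \<le> 2 ^ k")
  case True
  with assms show ?thesis using that[of Z "{}"] by simp
next
  case False
  then obtain T where T: "T \<subseteq> Z" "card T = 2 ^ k"
    by (meson nat_le_linear obtain_subset_with_card_n)
  then have "finite T" using assms finite_subset by blast
  with T assms have "card (Z - T) \<le> 2 ^ k" by (simp add: card_Diff_subset)
  with T \<open>finite T\<close> assms(1) show ?thesis using that[of T "Z - T"]
    by (metis Diff_partition finite_Diff order_refl)
qed

text \<open>Each bit halves the set of candidate values. The premise \<open>ask\<close> leaves open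
  who speaks, so that one induction serves both players; \<open>D\<close> is generalized because
  every bit refines it.\<close>

lemma solvable_within_announce:
  assumes ask: "\<And>n D W. solvable_within R n (\<lambda>x y. D x y \<and> e x y \<in> W) \<Longrightarrow>
      solvable_within R n (\<lambda>x y. D x y \<and> e x y \<notin> W) \<Longrightarrow> solvable_within R (Suc n) D"
    and "finite Z" "card Z \<le> 2 ^ k" "\<And>x y. D x y \<Longrightarrow> e x y \<in> Z"
    and "\<And>z. z \<in> Z \<Longrightarrow> solvable_within R m (\<lambda>x y. D x y \<and> e x y = z)"
  shows "solvable_within R (k + m) D"
  using assms(2-)
proof (induction k arbitrary: Z D)
  case 0
  show ?case
  proof (cases "Z = {}")
    case True
    with 0(3) show ?thesis by (intro solvable_within_answer) auto
  next
    case False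
    with 0(1,2) have "card Z = 1" by (simp add: Suc_leI card_gt_0_iff le_antisym)
    then obtain z where "Z = {z}" by (rule card_1_singletonE)
    with 0(3) 0(4)[of z] show ?thesis by (auto intro: solvable_within_mono)
  qed
next
  case (Suc k)
  obtain Z1 Z2 where Z: "Z = Z1 \<union> Z2" "finite Z1" "finite Z2" "card Z1 \<le> 2 ^ k" "card Z2 \<le> 2 ^ k"
    using halve_finite_set[OF Suc.prems(1,2)] by blast
  have "solvable_within R (k + m) (\<lambda>x y. D x y \<and> e x y \<in> Z1)"
    by (rule Suc.IH[OF Z(2,4)]) (use Suc.prems(4) Z(1) in \<open>auto intro: solvable_within_mono\<close>)
  moreover have "solvable_within R (k + m) (\<lambda>x y. D x y \<and> e x y \<notin> Z1)"
    by (rule Suc.IH[OF Z(3,5)]) (use Suc.prems(3,4) Z(1) in \<open>auto intro: solvable_within_mono\<close>)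
  ultimately show ?case
    using ask by simp
qed

lemma solvable_within_announce_A:
  assumes "finite Z" "card Z \<le> 2 ^ k" "\<And>x y. D x y \<Longrightarrow> e x \<in> Z"
    and "\<And>z. z \<in> Z \<Longrightarrow> solvable_within R m (\<lambda>x y. D x y \<and> e x = z)"
  shows "solvable_within R (k + m) D"
proof (rule solvable_within_announce[where e = "\<lambda>x y. e x"])
  show "solvable_within R (Suc n) D'"
    if "solvable_within R n (\<lambda>x y. D' x y \<and> e x \<in> W)"
      "solvable_within R n (\<lambda>x y. D' x y \<and> e x \<notin> W)" for n D' W
    using solvable_within_ask_A[where q = "\<lambda>x. e x \<in> W"] that by blast
qed (use assms in auto)

lemma solvable_within_announce_B:
  assumes "finite Z" "card Z \<le> 2 ^ k" "\<And>x y. D x y \<Longrightarrow> e y \<in> Z"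
    and "\<And>z. z \<in> Z \<Longrightarrow> solvable_within R m (\<lambda>x y. D x y \<and> e y = z)"
  shows "solvable_within R (k + m) D"
proof (rule solvable_within_announce[where e = "\<lambda>x y. e y"])
  show "solvable_within R (Suc n) D'"
    if "solvable_within R n (\<lambda>x y. D' x y \<and> e y \<in> W)"
      "solvable_within R n (\<lambda>x y. D' x y \<and> e y \<notin> W)" for n D' W
    using solvable_within_ask_B[where q = "\<lambda>y. e y \<in> W"] that by blast
qed (use assms in auto)

subsection \<open>Sperner's lemma\<close>

lemma vertices_convex_hull_affine_independent:
  fixes C :: "'a::euclidean_space set"
  assumes "\<not> affine_dependent C"
  shows "vertices (convex hull C) = C"
  using assms by (auto simp: vertices_def extreme_point_of_convex_hull_affine_independent)

lemma simplex_vertices: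
  fixes S :: "'a::euclidean_space set"
  assumes "n simplex S"
  shows "finite (vertices S)" "int (card (vertices S)) = n + 1" "S = convex hull (vertices S)"
proof -
  obtain C where C: "finite C" "\<not> affine_dependent C" "int (card C) = n + 1" "S = convex hull C"
    using assms unfolding simplex by blast
  then have "vertices S = C" by (simp add: vertices_convex_hull_affine_independent)
  with C show "finite (vertices S)" "int (card (vertices S)) = n + 1" "S = convex hull (vertices S)"
    by simp_all
qed

lemma vertices_face_of:
  assumes "F face_of S"
  shows "vertices F \<subseteq> vertices S"
  using extreme_point_of_face[OF assms] by (auto simp: vertices_def)

lemma finite_points:
  fixes K :: "'a::euclidean_space set set"
  assumes "simplicial_complex K"
  shows "finite (points K)"
proof -
  have "finite K" "\<And>S. S \<in> K \<Longrightarrow> \<exists>n. n simplex S"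
    using assms by (auto simp: simplicial_complex_def)
  then show ?thesis
    unfolding points_def using simplex_vertices(1) by (metis finite_UN)
qed

text \<open>An inclusion-minimal simplex of \<open>K\<close> containing \<open>x\<close> works: if
  \<open>x\<close> were on its relative boundary, a facet containing \<open>x\<close>, again in
  \<open>K\<close>, would be smaller.\<close>

lemma simplicial_complex_rel_interior_cover:
  fixes K :: "'a::euclidean_space set set"
  assumes K: "simplicial_complex K" and x: "x \<in> \<Union>K"
  obtains S where "S \<in> K" "x \<in> rel_interior S"
proof -
  have "finite {S \<in> K. x \<in> S}" using K by (simp add: simplicial_complex_def)
  moreover have "{S \<in> K. x \<in> S} \<noteq> {}" using x by blast
  ultimately obtain S where S: "S \<in> K" "x \<in> S" and min: "\<And>T. T \<in> K \<Longrightarrow> x \<in> T \<Longrightarrow> T \<subseteq> S \<Longrightarrow> T = S"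
    using finite_has_minimal[of "{S \<in> K. x \<in> S}"] by blast
  have "x \<in> rel_interior S"
  proof (rule ccontr)
    assume "x \<notin> rel_interior S"
    moreover have ph: "polyhedron S"
      using K S(1) simplex_imp_polyhedron unfolding simplicial_complex_def by blast
    ultimately obtain F where F: "F facet_of S" "x \<in> F"
      using S(2) rel_boundary_of_polyhedron[OF ph] by blast
    then have "F \<in> K" "F \<subseteq> S"
      using K S(1) unfolding simplicial_complex_def by (meson facet_of_imp_face_of facet_of_imp_subset)+
    with min F have "S facet_of S" by blast
    then show False by (simp add: facet_of_irrefl)
  qed
  with S that show ?thesis by blast
qed

text \<open>\<open>S \<inter> T\<close> is a face of \<open>S\<close> meeting its relative interior,
  hence equal to \<open>S\<close>; so \<open>S\<close> is a face of \<open>T\<close>.\<close>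

lemma simplicial_complex_vertices_subset:
  fixes K :: "'a::euclidean_space set set"
  assumes K: "simplicial_complex K" and S: "S \<in> K" "T \<in> K" and x: "x \<in> rel_interior S" "x \<in> T"
  shows "vertices S \<subseteq> vertices T"
proof -
  have "S \<inter> T face_of S" "T \<inter> S face_of T"
    using K S unfolding simplicial_complex_def by blast+
  moreover have "S \<inter> T = S"
    using face_of_disjoint_rel_interior[OF \<open>S \<inter> T face_of S\<close>] x rel_interior_subset by blast
  ultimately show ?thesis
    by (metis inf_commute vertices_face_of)
qed

definition opposite_facet :: "nat \<Rightarrow> (nat \<Rightarrow> 'a::euclidean_space) \<Rightarrow> nat \<Rightarrow> 'a set" where
  "opposite_facet d v i = convex hull (v ` ({..d} - {i}))"

lemma opposite_facet_face_of:
  assumes "nondegenerate d v"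
  shows "opposite_facet d v i face_of big_simplex d v"
proof -
  have "\<not> affine_dependent (v ` {..d})" using assms by (simp add: nondegenerate_def)
  then show ?thesis
    unfolding big_simplex_def opposite_facet_def
    by (subst face_of_convex_hull_affine_independent) (auto intro!: exI[of _ "v ` ({..d} - {i})"])
qed

lemma notin_opposite_facet:
  assumes "nondegenerate d v" "i \<le> d"
  shows "v i \<notin> opposite_facet d v i"
proof
  assume "v i \<in> opposite_facet d v i"
  moreover have "v ` ({..d} - {i}) = v ` {..d} - {v i}"
    using assms by (auto simp: nondegenerate_def inj_on_def)
  ultimately have "v i \<in> affine hull (v ` {..d} - {v i})"
    using convex_hull_subset_affine_hull unfolding opposite_facet_def by fastforce
  then have "affine_dependent (v ` {..d})"
    using assms(2) unfolding affine_dependent_def by blast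
  with assms show False by (simp add: nondegenerate_def)
qed

text \<open>The facet is a face of the big simplex, so together with \<open>x\<close> it would
  contain the smallest face around \<open>x\<close>, and hence \<open>v i\<close>.\<close>

lemma sperner_at_notin_opposite_facet:
  assumes "nondegenerate d v" "sperner_at d v x i"
  shows "x \<notin> opposite_facet d v i"
proof
  assume "x \<in> opposite_facet d v i"
  then have "smallest_face (big_simplex d v) x \<subseteq> opposite_facet d v i"
    using opposite_facet_face_of[OF assms(1)] unfolding smallest_face_def by blast
  moreover have "v i \<in> smallest_face (big_simplex d v) x" "i \<le> d"
    using assms(2) by (auto simp: sperner_at_def vertices_def extreme_point_of_def)
  ultimately show False using notin_opposite_facet[OF assms(1)] by blast
qed

text \<open>
  Sperner's lemma from Brouwer's theorem: let \<open>g i x\<close> be the distance of \<open>x\<close> to the union of the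
  simplices that lack color \<open>i\<close>, and push every \<open>x\<close> towards those \<open>v i\<close> for which \<open>g i x\<close> is below
  the average. A moved fixed point would lie on a facet opposite to some \<open>v i\<close> with
  \<open>g i x > 0\<close>, but on that facet \<open>g i\<close> vanishes.
\<close>

lemma sperner_panchromatic:
  fixes v :: "nat \<Rightarrow> 'a::euclidean_space"
  assumes d: "d \<ge> 1" and nd: "nondegenerate d v" and tri: "triangulates K (big_simplex d v)"
    and c: "\<And>p. p \<in> points K \<Longrightarrow> c p \<le> d \<and> p \<notin> opposite_facet d v (c p)"
  obtains S where "S \<in> K" "int d simplex S" "c ` vertices S = {..d}"
proof -
  define U where "U i = \<Union>{S \<in> K. i \<notin> c ` vertices S}" for i
  define g where "g i x = infdist x (U i)" for i x
  have K: "simplicial_complex K" and UK: "\<Union>K = big_simplex d v"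
    using tri by (auto simp: triangulates_def)
  have "finite K" and simp: "\<And>S. S \<in> K \<Longrightarrow> \<exists>n. n simplex S"
    using K by (auto simp: simplicial_complex_def)
  have clU: "closed (U i)" for i
    unfolding U_def using \<open>finite K\<close> simp closed_simplex by (intro closed_Union) auto
  have facetU: "opposite_facet d v i \<subseteq> U i" for i
  proof
    fix x assume x: "x \<in> opposite_facet d v i"
    then have "x \<in> \<Union>K" using opposite_facet_face_of[OF nd] UK face_of_imp_subset by blast
    then obtain S where S: "S \<in> K" "x \<in> rel_interior S"
      using simplicial_complex_rel_interior_cover[OF K] by blast
    \<comment> \<open>A face that meets the relative interior of \<open>S\<close> contains
      \<open>S\<close>, so all vertices of \<open>S\<close> lie on the facet and avoid color
      \<open>i\<close>.\<close>
    then have sub: "S \<subseteq> opposite_facet d v i"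
      using UK x by (intro subset_of_face_of[OF opposite_facet_face_of[OF nd]]) auto
    have "i \<noteq> c p" if "p \<in> vertices S" for p
      using c[of p] that S(1) sub by (auto simp: points_def vertices_def extreme_point_of_def)
    then show "x \<in> U i"
      using S rel_interior_subset unfolding U_def by blast
  qed
  \<comment> \<open>\<open>infdist\<close> to the empty set is 0 by convention, so \<open>g0\<close>
    relies on this; \<open>d \<ge> 1\<close> makes the facets nonempty.\<close>
  have neU: "U i \<noteq> {}" for i
  proof -
    have "(if i = 0 then 1 else 0) \<in> {..d} - {i}" using d by simp
    then have "{..d} - {i} \<noteq> {}" by blast
    then show ?thesis using facetU[of i] by (auto simp: opposite_facet_def)
  qed
  have g0: "g i x = 0 \<longleftrightarrow> x \<in> U i" for i x
    using in_closed_iff_infdist_zero[OF clU neU] by (simp add: g_def)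
  have gnn: "g i x \<ge> 0" for i x by (simp add: g_def infdist_nonneg)
  define avg where "avg x = (\<Sum>i\<le>d. g i x) / (d + 1)" for x
  have avg_pos: "avg x > 0" if x: "x \<in> big_simplex d v" for x
  proof -
    obtain S where S: "S \<in> K" "x \<in> rel_interior S"
      using simplicial_complex_rel_interior_cover[OF K] x UK by blast
    then have "S \<noteq> {}" using rel_interior_subset by blast
    then obtain p where p: "p \<in> vertices S"
      using simp[OF S(1)] simplex_vertices(3) by (metis convex_hull_empty ex_in_conv)
    then have "c p \<le> d" using c S(1) by (auto simp: points_def)
    \<comment> \<open>Every simplex of \<open>K\<close> containing \<open>x\<close> has
      \<open>p\<close> as a vertex and so shows the color \<open>c p\<close>.\<close>
    moreover have "x \<notin> U (c p)"
      using simplicial_complex_vertices_subset[OF K S(1) _ S(2)] p unfolding U_def by blast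
    then have "g (c p) x > 0" using g0 gnn by (metis less_eq_real_def)
    ultimately have "(\<Sum>i\<le>d. g i x) > 0" using gnn by (intro sum_pos2[of _ "c p"]) auto
    then show ?thesis by (simp add: avg_def)
  qed
  define m where "m i x = max 0 (avg x - g i x)" for i x
  define M where "M x = (\<Sum>i\<le>d. m i x)" for x
  \<comment> \<open>This is the weighted mean of \<open>x\<close> with weight 1 and the
    \<open>v i\<close> with weights \<open>m i x\<close>. A fixed point with \<open>M x > 0\<close>
    is therefore a weighted mean of the \<open>v i\<close> alone.\<close>
  define h where "h x = (1 / (1 + M x)) *\<^sub>R (x + (\<Sum>i\<le>d. m i x *\<^sub>R v i))" for x
  have mnn: "m i x \<ge> 0" for i x by (simp add: m_def)
  have Mnn: "M x \<ge> 0" for x by (simp add: M_def mnn sum_nonneg)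
  have contm: "continuous_on A (m i)" for A i
    unfolding m_def avg_def g_def by (intro continuous_intros) auto
  have "continuous_on (big_simplex d v) h"
    unfolding h_def M_def
    by (intro continuous_intros contm ballI)
      (use Mnn in \<open>simp add: M_def add_nonneg_eq_0_iff\<close>)
  moreover have cvx: "convex (big_simplex d v)" by (simp add: big_simplex_def)
  moreover have "compact (big_simplex d v)"
    by (simp add: big_simplex_def finite_imp_compact_convex_hull)
  moreover have "big_simplex d v \<noteq> {}" by (auto simp: big_simplex_def)
  moreover have "h \<in> big_simplex d v \<rightarrow> big_simplex d v"
  proof
    fix x assume x: "x \<in> big_simplex d v"
    show "h x \<in> big_simplex d v"
    proof (cases "M x = 0")
      case True
      then have "\<forall>i\<in>{..d}. m i x = 0" by (simp add: M_def sum_nonneg_eq_0_iff mnn)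
      then show ?thesis using True x by (simp add: h_def)
    next
      case False
      then have Mp: "M x > 0" using Mnn by (simp add: less_le)
      define y where "y = (\<Sum>i\<le>d. (m i x / M x) *\<^sub>R v i)"
      have "(\<Sum>i\<le>d. m i x / M x) = 1"
        using Mp by (simp add: M_def flip: sum_divide_distrib)
      then have y: "y \<in> big_simplex d v"
        unfolding y_def using mnn Mp
        by (intro convex_sum cvx) (auto simp: big_simplex_def hull_inc)
      have "M x *\<^sub>R y = (\<Sum>i\<le>d. m i x *\<^sub>R v i)"
        using Mp by (simp add: y_def scaleR_right.sum)
      then have "h x = (1 / (1 + M x)) *\<^sub>R x + (M x / (1 + M x)) *\<^sub>R y"
        by (simp add: h_def scaleR_right_distrib flip: \<open>M x *\<^sub>R y = _\<close>)
      also have "\<dots> \<in> big_simplex d v"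
        using Mp by (intro convexD[OF cvx x y]) (auto simp: field_simps)
      finally show ?thesis .
    qed
  qed
  ultimately obtain x where x: "x \<in> big_simplex d v" and fx: "h x = x"
    using brouwer by blast
  have eq: "(\<Sum>i\<le>d. m i x *\<^sub>R v i) = M x *\<^sub>R x"
  proof -
    have "(1 + M x) *\<^sub>R h x = x + (\<Sum>i\<le>d. m i x *\<^sub>R v i)"
      using Mnn[of x] by (simp add: h_def add_nonneg_eq_0_iff)
    then show ?thesis by (simp add: fx scaleR_left_distrib)
  qed
  have "g i x > 0" if "i \<le> d" for i
  proof (rule ccontr)
    assume neg: "\<not> g i x > 0"
    have avgx: "avg x > 0" by (rule avg_pos[OF x])
    have "m i x > 0" using neg avgx by (simp add: m_def)
    then have Mp: "M x > 0" using that mnn unfolding M_def by (intro sum_pos2[of _ i]) auto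
    \<comment> \<open>With \<open>g i x\<close> strictly below the average, some value exceeds it.
      Such a \<open>j\<close> has weight 0, which puts \<open>x\<close> on the facet opposite to
      \<open>v j\<close>.\<close>
    have "\<exists>j\<le>d. g j x > avg x"
    proof (rule ccontr)
      assume "\<not> ?thesis"
      then have "(\<Sum>j\<le>d. g j x) < (\<Sum>j\<le>d. avg x)"
        using neg avgx that by (intro sum_strict_mono_ex1) (auto simp: not_less intro!: bexI[of _ i])
      then show False by (simp add: avg_def field_simps)
    qed
    then obtain j where j: "j \<le> d" "g j x > avg x" by blast
    then have mj: "m j x = 0" by (simp add: m_def)
    define w where "w k = m k x / M x" for k
    have "x = (\<Sum>k\<le>d. w k *\<^sub>R v k)"
    proof -
      have "(\<Sum>k\<le>d. w k *\<^sub>R v k) = (1 / M x) *\<^sub>R (\<Sum>k\<le>d. m k x *\<^sub>R v k)"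
        by (simp add: w_def scaleR_right.sum)
      then show ?thesis using eq Mp by simp
    qed
    also have "\<dots> = (\<Sum>k\<in>{..d} - {j}. w k *\<^sub>R v k)"
      by (rule sum.mono_neutral_right) (auto simp: w_def mj)
    also have "\<dots> \<in> opposite_facet d v j"
    proof -
      have "(\<Sum>k\<in>{..d} - {j}. w k) = (\<Sum>k\<le>d. w k)"
        by (rule sum.mono_neutral_left) (auto simp: w_def mj)
      also have "\<dots> = 1"
        using Mp by (simp add: w_def M_def flip: sum_divide_distrib)
      finally show ?thesis
        unfolding opposite_facet_def using mnn Mp
        by (intro convex_sum) (auto simp: w_def hull_inc)
    qed
    finally have "g j x = 0" using facetU g0 by blast
    with j avgx show False by simp
  qed
  then have xU: "x \<notin> U i" if "i \<le> d" for i using that g0 by (metis less_irrefl)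
  obtain S where S: "S \<in> K" "x \<in> S" using x UK by blast
  have "i \<in> c ` vertices S" if "i \<le> d" for i using xU[OF that] S by (auto simp: U_def)
  then have col: "c ` vertices S = {..d}" using c S(1) by (auto simp: points_def)
  obtain n where n: "n simplex S" using simp[OF S(1)] by blast
  have "int d + 1 \<le> n + 1"
    using card_image_le[OF simplex_vertices(1)[OF n], of c] simplex_vertices(2)[OF n] col by simp
  moreover have "n \<le> d"
  proof -
    have "n = aff_dim S" using aff_dim_simplex[OF n] by simp
    also have "\<dots> \<le> aff_dim (big_simplex d v)" using S UK by (intro aff_dim_subset) blast
    also have "\<dots> = int (card (v ` {..d})) - 1"
      using nd by (simp add: big_simplex_def nondegenerate_def aff_dim_convex_hull aff_dim_affine_independent)
    also have "\<dots> = d" using nd by (simp add: nondegenerate_def card_image)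
    finally show ?thesis .
  qed
  ultimately have "n = int d" by simp
  with n S col that show ?thesis by blast
qed

subsection \<open>The path of player A\<close>

text \<open>\<open>S\<close> has \<open>t + 2\<close> vertices, so for \<open>p \<noteq> q\<close>
  the other \<open>t\<close> carry each of \<open>A\<close>'s colors once. The case
  \<open>p = q\<close> only adds loops, which are harmless: the search ends at an edge whose ends
  \<open>B\<close> colors differently.\<close>

definition switch_simplex ::
  "nat \<Rightarrow> 'a::euclidean_space set set \<Rightarrow> ('a \<rightharpoonup> nat) \<Rightarrow> 'a \<Rightarrow> 'a \<Rightarrow> 'a set \<Rightarrow> bool" where
  "switch_simplex t K cA p q S \<longleftrightarrow>
     S \<in> K \<and> int (Suc t) simplex S \<and> p \<in> vertices S \<and> q \<in> vertices S \<and>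
     cA p = None \<and> cA q = None \<and> cA ` (vertices S - {p, q}) = Some ` {..<t}"

definition switch_graph :: "nat \<Rightarrow> 'a::euclidean_space set set \<Rightarrow> ('a \<rightharpoonup> nat) \<Rightarrow> ('a \<times> 'a) set" where
  "switch_graph t K cA = {(p, q). \<exists>S. switch_simplex t K cA p q S}"

lemma switch_graph_subset:
  "switch_graph t K cA \<subseteq> {p \<in> points K. cA p = None} \<times> {p \<in> points K. cA p = None}"
  by (auto simp: switch_graph_def switch_simplex_def points_def)

text \<open>
  Otherwise give color \<open>t\<close> to the points that are reachable from the facet opposite to \<open>v (Suc t)\<close>
  and \<open>Suc t\<close> to the other points not colored by \<open>cA\<close>. Sperner's lemma yields a panchromatic
  simplex, whose last two vertices form an edge leaving the reachable set.
\<close>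

lemma switch_graph_connects_facets:
  fixes v :: "nat \<Rightarrow> 'a::euclidean_space"
  assumes nd: "nondegenerate (Suc t) v" and tri: "triangulates K (big_simplex (Suc t) v)"
    and cA: "cA \<in> inputs K {..<t}" and sp: "\<And>p i. cA p = Some i \<Longrightarrow> sperner_at (Suc t) v p i"
  obtains a b where "a \<in> points K" "cA a = None" "a \<in> opposite_facet (Suc t) v (Suc t)"
    "b \<in> points K" "cA b = None" "b \<in> opposite_facet (Suc t) v t" "(a, b) \<in> (switch_graph t K cA)\<^sup>*"
proof (rule ccontr)
  assume not_thesis: "\<not> thesis"
  note thesisI = that
  have no: False if "a \<in> points K" "cA a = None" "a \<in> opposite_facet (Suc t) v (Suc t)"
    "b \<in> points K" "cA b = None" "b \<in> opposite_facet (Suc t) v t" "(a, b) \<in> (switch_graph t K cA)\<^sup>*" for a b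
    using not_thesis thesisI[OF that] by blast
  define X where "X = (switch_graph t K cA)\<^sup>* ``
    {a \<in> points K. cA a = None \<and> a \<in> opposite_facet (Suc t) v (Suc t)}"
  define c where "c p = (case cA p of Some i \<Rightarrow> i | None \<Rightarrow> if p \<in> X then t else Suc t)" for p
  have lt: "i < t" if "cA p = Some i" for p i using cA that by (auto simp: inputs_def ran_def)
  have "c p \<le> Suc t \<and> p \<notin> opposite_facet (Suc t) v (c p)" if p: "p \<in> points K" for p
  proof (cases "cA p")
    case None
    \<comment> \<open>No path joins the two facets, so \<open>X\<close> misses the facet opposite to
      \<open>v t\<close>. Uncolored points of the other facet are in \<open>X\<close> by the empty
      path.\<close>
    then have "p \<notin> opposite_facet (Suc t) v t" if "p \<in> X"
      using no[of _ p] that p unfolding X_def by blast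
    moreover have "p \<notin> opposite_facet (Suc t) v (Suc t)" if "p \<notin> X"
      using that p None unfolding X_def by blast
    ultimately show ?thesis using None by (simp add: c_def)
  next
    case (Some i)
    then show ?thesis
      using sperner_at_notin_opposite_facet[OF nd sp[OF Some]] lt[OF Some] by (simp add: c_def)
  qed
  then obtain S where S: "S \<in> K" "int (Suc t) simplex S" "c ` vertices S = {..Suc t}"
    using sperner_panchromatic[OF _ nd tri, of c] by auto
  \<comment> \<open>There are as many vertices as colors, so \<open>c\<close> is injective on them,
    and removing \<open>p\<close> and \<open>q\<close> leaves exactly the colors below
    \<open>t\<close>.\<close>
  have "finite (vertices S)" "card (vertices S) = card (c ` vertices S)"
    using simplex_vertices[OF S(2)] S(3) by simp_all
  then have inj: "inj_on c (vertices S)" by (simp add: eq_card_imp_inj_on)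
  obtain p q where pq: "p \<in> vertices S" "c p = t" "q \<in> vertices S" "c q = Suc t"
    using S(3) by (metis atMost_iff imageE le_SucI order_refl)
  have p: "cA p = None" "p \<in> X" and q: "cA q = None" "q \<notin> X"
    using pq(2,4) lt[of p] lt[of q] by (auto simp: c_def split: option.splits if_splits)
  have "c ` (vertices S - {p, q}) = {..Suc t} - {t, Suc t}"
    using inj_on_image_set_diff[OF inj, of "vertices S" "{p, q}"] pq S(3) by simp
  also have "\<dots> = {..<t}" by auto
  finally have cimg: "c ` (vertices S - {p, q}) = {..<t}" .
  have "cA w = Some (c w)" if "w \<in> vertices S - {p, q}" for w
  proof -
    have "c w < t" using cimg that by blast
    then show ?thesis by (auto simp: c_def split: option.splits if_splits)
  qed
  then have "cA ` (vertices S - {p, q}) = Some ` c ` (vertices S - {p, q})"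
    by (simp add: image_image)
  then have "switch_simplex t K cA p q S"
    unfolding switch_simplex_def cimg using S pq p q by simp
  then have "(p, q) \<in> switch_graph t K cA" by (auto simp: switch_graph_def)
  with p q show False unfolding X_def by (auto intro: rtrancl_into_rtrancl)
qed

text \<open>Repetitions \<open>f i = f (Suc i)\<close> pad all paths to a common length
  \<open>N\<close>, so that both players can follow the indices queried in the search.\<close>

definition switch_path ::
  "nat \<Rightarrow> (nat \<Rightarrow> 'a::euclidean_space) \<Rightarrow> 'a set set \<Rightarrow> ('a \<rightharpoonup> nat) \<Rightarrow> nat \<Rightarrow> (nat \<Rightarrow> 'a) \<Rightarrow> bool" where
  "switch_path t v K cA N f \<longleftrightarrow>
     f 0 \<in> opposite_facet (Suc t) v (Suc t) \<and> f N \<in> opposite_facet (Suc t) v t \<and>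
     (\<forall>i. f i \<in> points K \<and> cA (f i) = None) \<and>
     (\<forall>i. f i = f (Suc i) \<or> (f i, f (Suc i)) \<in> switch_graph t K cA)"

lemma switch_path_exists:
  fixes v :: "nat \<Rightarrow> 'a::euclidean_space"
  assumes nd: "nondegenerate (Suc t) v" and tri: "triangulates K (big_simplex (Suc t) v)"
    and cA: "cA \<in> inputs K {..<t}" and sp: "\<And>p i. cA p = Some i \<Longrightarrow> sperner_at (Suc t) v p i"
    and N: "(card (points K))\<^sup>2 \<le> N"
  shows "\<exists>f. switch_path t v K cA N f"
proof -
  let ?R = "switch_graph t K cA"
  obtain a b where ab: "a \<in> points K" "cA a = None" "a \<in> opposite_facet (Suc t) v (Suc t)"
    "b \<in> points K" "cA b = None" "b \<in> opposite_facet (Suc t) v t" "(a, b) \<in> ?R\<^sup>*"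
    using switch_graph_connects_facets[OF nd tri cA sp] by blast
  have fin: "finite (points K)" using tri finite_points by (auto simp: triangulates_def)
  have sub: "?R \<subseteq> points K \<times> points K" using switch_graph_subset by blast
  then have "finite ?R" using finite_subset[OF sub] fin by blast
  \<comment> \<open>Connected points are joined by a walk with at most as many steps as there are
    edges, which explains the square in the bound on \<open>N\<close>.\<close>
  have "card ?R \<le> N"
    using card_mono[OF _ sub] fin N by (simp add: card_cartesian_product power2_eq_square)
  moreover from \<open>finite ?R\<close> obtain n where n: "n \<le> card ?R" "(a, b) \<in> ?R ^^ n"
    using ab(7) rtrancl_finite_eq_relpow[of ?R] by auto
  ultimately have "n \<le> N" by simp
  from n(2) obtain f where f: "f 0 = a" "f n = b" "\<And>i. i < n \<Longrightarrow> (f i, f (Suc i)) \<in> ?R"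
    unfolding relpow_fun_conv by blast
  have step: "f (min i n) = f (min (Suc i) n) \<or> (f (min i n), f (min (Suc i) n)) \<in> ?R" for i
    using f(3)[of i] by (cases "i < n") (auto simp: min_def)
  have "f (min i n) \<in> points K \<and> cA (f (min i n)) = None" for i
  proof (induction i)
    case 0
    then show ?case using f ab by simp
  next
    case (Suc i)
    then show ?case using step[of i] switch_graph_subset by fastforce
  qed
  with step f \<open>n \<le> N\<close> ab have "switch_path t v K cA N (\<lambda>i. f (min i n))"
    unfolding switch_path_def by (simp add: min_absorb2)
  then show ?thesis by blast
qed

subsection \<open>Binary search\<close>

text \<open>A simplex is determined by its set of \<open>d + 1\<close> vertices.\<close>

lemma card_simplices_le:
  fixes K :: "'a::euclidean_space set set"
  assumes "simplicial_complex K"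
  shows "card {S \<in> K. int d simplex S} \<le> card (points K) ^ (d + 1)"
proof -
  let ?Z = "{S \<in> K. int d simplex S}" and ?B = "{V. V \<subseteq> points K \<and> card V = d + 1}"
  have fin: "finite (points K)" by (rule finite_points[OF assms])
  have "inj_on vertices ?Z" using simplex_vertices(3) by (metis (mono_tags, lifting) inj_onI mem_Collect_eq)
  moreover have "vertices ` ?Z \<subseteq> ?B"
    using simplex_vertices(2) by (fastforce simp: points_def)
  ultimately have "card ?Z \<le> card ?B" using fin by (intro card_inj_on_le) auto
  also have "\<dots> = card (points K) choose (d + 1)" by (rule n_subsets[OF fin])
  also have "\<dots> \<le> card (points K) ^ (d + 1)"
    by (cases "d + 1 \<le> card (points K)") (simp_all only: binomial_le_pow binomial_eq_0 not_le le0)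
  finally show ?thesis .
qed

text \<open>
  After \<open>A\<close> has named the simplex, \<open>B\<close> still has to check that the vertices other than \<open>p\<close> and \<open>q\<close>
  are not colored twice.
\<close>

lemma solvable_within_switch_simplex:
  fixes v :: "nat \<Rightarrow> 'a::euclidean_space"
  assumes K: "simplicial_complex K" and n: "card (points K) \<le> 2 ^ L"
    and D: "\<And>x y. D x y \<Longrightarrow> y p = Some t \<and> y q = Some (Suc t) \<and> (\<exists>S. switch_simplex t K x p q S)"
  shows "solvable_within (sperner_answer (Suc t) v K) ((t + 2) * L + Suc L) D"
proof (rule solvable_within_announce_A[where e = "\<lambda>x. SOME S. switch_simplex t K x p q S"])
  let ?Z = "{S \<in> K. int (Suc t) simplex S}"
  let ?S = "\<lambda>x. SOME S. switch_simplex t K x p q S"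
  have sw: "switch_simplex t K x p q (?S x)" if "D x y" for x y
    using D[OF that] by (metis someI_ex)
  show "finite ?Z" using K by (simp add: simplicial_complex_def)
  have "card ?Z \<le> card (points K) ^ (Suc t + 1)" by (rule card_simplices_le[OF K])
  also have "\<dots> \<le> (2 ^ L) ^ (t + 2)" using power_mono[OF n, of "t + 2"] by simp
  finally show "card ?Z \<le> 2 ^ ((t + 2) * L)" by (simp only: mult.commute power_mult)
  show "?S x \<in> ?Z" if "D x y" for x y
    using sw[OF that, unfolded switch_simplex_def[of _ _ _ _ _ "?S x"]] by blast
  fix S assume S: "S \<in> ?Z"
  have VP: "vertices S \<subseteq> points K" using S by (auto simp: points_def)
  define E where "E x y \<longleftrightarrow> D x y \<and> switch_simplex t K x p q S" for x y
  define bad where "bad y w \<longleftrightarrow> w \<in> vertices S - {p, q} \<and> y w \<noteq> None" for y :: "'a \<rightharpoonup> nat" and w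
  \<comment> \<open>A vertex that \<open>B\<close> colors besides \<open>p\<close> and
    \<open>q\<close> is colored by \<open>A\<close> too, hence a violation that \<open>B\<close>
    names with \<open>L\<close> bits.\<close>
  have "solvable_within (sperner_answer (Suc t) v K) (L + 0) (\<lambda>x y. E x y \<and> (\<exists>w. bad y w))"
  proof (rule solvable_within_announce_B[where e = "\<lambda>y. SOME w. bad y w", OF finite_points[OF K] n])
    show "(SOME w. bad y w) \<in> points K" if "E x y \<and> (\<exists>w. bad y w)" for x y
      using someI_ex[of "bad y"] that VP unfolding bad_def by blast
    fix w assume w: "w \<in> points K"
    show "solvable_within (sperner_answer (Suc t) v K) 0
      (\<lambda>x y. (E x y \<and> (\<exists>w. bad y w)) \<and> (SOME w. bad y w) = w)"
    proof (rule solvable_within_answer[where z = "Violation w"])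
      fix x y assume "(E x y \<and> (\<exists>w. bad y w)) \<and> (SOME w. bad y w) = w"
      then have "bad y w" "switch_simplex t K x p q S"
        using someI_ex[of "bad y"] by (auto simp: E_def)
      then have "x w \<in> Some ` {..<t}" "y w \<noteq> None" unfolding switch_simplex_def bad_def by blast+
      then show "sperner_answer (Suc t) v K x y (Violation w)" using w by auto
    qed
  qed
  moreover have "solvable_within (sperner_answer (Suc t) v K) (L + 0) (\<lambda>x y. E x y \<and> \<not> (\<exists>w. bad y w))"
  proof (rule solvable_within_answer[where z = "Panchromatic S"])
    fix x y assume xy: "E x y \<and> \<not> (\<exists>w. bad y w)"
    then have y: "y p = Some t" "y q = Some (Suc t)" and s: "switch_simplex t K x p q S"
      using D by (auto simp: E_def)
    have "combine x y w = x w" if "w \<in> vertices S - {p, q}" for w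
      using xy that by (auto simp: bad_def combine_def split: option.split)
    then have *: "combine x y ` (vertices S - {p, q}) = Some ` {..<t}"
      using s by (simp add: switch_simplex_def)
    have pq: "combine x y p = Some t" "combine x y q = Some (Suc t)"
      using s y by (auto simp: combine_def switch_simplex_def)
    have "vertices S = insert p (insert q (vertices S - {p, q}))"
      using s by (auto simp: switch_simplex_def)
    then have "combine x y ` vertices S = combine x y ` insert p (insert q (vertices S - {p, q}))"
      by (rule arg_cong)
    also have "\<dots> = insert (Some t) (insert (Some (Suc t)) (Some ` {..<t}))"
      by (simp only: image_insert pq *)
    also have "\<dots> = Some ` {..Suc t}" by (auto simp: le_Suc_eq less_le)
    finally show "sperner_answer (Suc t) v K x y (Panchromatic S)" using S by simp
  qed
  ultimately have "solvable_within (sperner_answer (Suc t) v K) (Suc L) E"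
    using solvable_within_ask_B[where q = "\<lambda>y. \<exists>w. bad y w"] by simp
  then show "solvable_within (sperner_answer (Suc t) v K) (Suc L) (\<lambda>x y. D x y \<and> ?S x = S)"
    by (rule solvable_within_mono) (use sw in \<open>auto simp: E_def\<close>)
qed

text \<open>\<open>A\<close> names \<open>e x\<close> with \<open>L\<close> bits, and
  \<open>B\<close> tells with at most two bits whether its color is \<open>t\<close>,
  \<open>Suc t\<close> or missing. A missing color is a violation, since \<open>A\<close> does not
  color \<open>e x\<close> either.\<close>

lemma solvable_within_query:
  fixes v :: "nat \<Rightarrow> 'a::euclidean_space"
  assumes K: "simplicial_complex K" and n: "card (points K) \<le> 2 ^ L"
    and D: "\<And>x y. D x y \<Longrightarrow> y \<in> inputs K {t..Suc t} \<and> e x \<in> points K \<and> x (e x) = None"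
    and t: "\<And>z. z \<in> points K \<Longrightarrow>
      solvable_within (sperner_answer (Suc t) v K) m (\<lambda>x y. D x y \<and> e x = z \<and> y z = Some t)"
    and Suc_t: "\<And>z. z \<in> points K \<Longrightarrow>
      solvable_within (sperner_answer (Suc t) v K) m (\<lambda>x y. D x y \<and> e x = z \<and> y z = Some (Suc t))"
  shows "solvable_within (sperner_answer (Suc t) v K) (L + (m + 2)) D"
proof (rule solvable_within_announce_A[where e = e, OF finite_points[OF K] n])
  let ?R = "sperner_answer (Suc t) v K"
  show "e x \<in> points K" if "D x y" for x y using D[OF that] by simp
  fix z assume z: "z \<in> points K"
  let ?D = "\<lambda>x y. D x y \<and> e x = z"
  \<comment> \<open>This branch is reached after one bit; its budget is raised to match the branch
    that takes two.\<close>
  have 1: "solvable_within ?R (Suc m) (\<lambda>x y. ?D x y \<and> y z = Some t)"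
    by (rule solvable_within_mono[OF t[OF z]]) auto
  have 2: "solvable_within ?R m (\<lambda>x y. (?D x y \<and> y z \<noteq> Some t) \<and> y z = Some (Suc t))"
    by (rule solvable_within_mono[OF Suc_t[OF z]]) auto
  have "solvable_within ?R m (\<lambda>x y. (?D x y \<and> y z \<noteq> Some t) \<and> y z \<noteq> Some (Suc t))"
  proof (rule solvable_within_answer[where z = "Violation z"])
    fix x y assume *: "(?D x y \<and> y z \<noteq> Some t) \<and> y z \<noteq> Some (Suc t)"
    then have "x z = None" "ran y \<subseteq> {t..Suc t}" using D[of x y] by (auto simp: inputs_def)
    moreover from this(2) * have "y z = None"
      by (cases "y z") (force simp: ran_def)+
    ultimately show "?R x y (Violation z)" using z by auto
  qed
  from solvable_within_ask_B[where q = "\<lambda>y. y z = Some t", OF 1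
      solvable_within_ask_B[where q = "\<lambda>y. y z = Some (Suc t)", OF 2 this]]
  show "solvable_within ?R (m + 2) ?D" by simp
qed

text \<open>A query at the midpoint leaves a half whose ends \<open>B\<close> again colors
  \<open>t\<close> and \<open>Suc t\<close>. After \<open>r\<close> queries of \<open>L + 2\<close>
  bits two neighbors remain; naming them takes \<open>2 * L\<close> bits, and the other summands pay
  for the simplex.\<close>

lemma solvable_within_binary_search:
  fixes v :: "nat \<Rightarrow> 'a::euclidean_space"
  assumes K: "simplicial_complex K" and n: "card (points K) \<le> 2 ^ L"
    and D: "\<And>x y. D x y \<Longrightarrow> y \<in> inputs K {t..Suc t} \<and> switch_path t v K x N (f x)"
  shows "solvable_within (sperner_answer (Suc t) v K) (r * (L + 2) + ((t + 2) * L + Suc L + 2 * L))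
    (\<lambda>x y. D x y \<and> y (f x j) = Some t \<and> y (f x (j + 2 ^ r)) = Some (Suc t))"
proof (induction r arbitrary: j)
  case 0
  let ?R = "sperner_answer (Suc t) v K" and ?m = "(t + 2) * L + Suc L"
  let ?D = "\<lambda>x y. D x y \<and> y (f x j) = Some t \<and> y (f x (j + 2 ^ 0)) = Some (Suc t)"
  have mem: "f x i \<in> points K" if "D x y" for x y i
    using D[OF that] by (simp add: switch_path_def)
  have "solvable_within ?R (L + (L + ?m)) ?D"
  proof (rule solvable_within_announce_A[where e = "\<lambda>x. f x j", OF finite_points[OF K] n])
    fix p
    show "solvable_within ?R (L + ?m) (\<lambda>x y. ?D x y \<and> f x j = p)"
    proof (rule solvable_within_announce_A[where e = "\<lambda>x. f x (Suc j)", OF finite_points[OF K] n])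
      fix q
      show "solvable_within ?R ?m (\<lambda>x y. (?D x y \<and> f x j = p) \<and> f x (Suc j) = q)"
      proof (rule solvable_within_switch_simplex[OF K n, of _ p t q])
        fix x y assume *: "(?D x y \<and> f x j = p) \<and> f x (Suc j) = q"
        \<comment> \<open>Different colors exclude a padding step, so the two neighbors form an
          edge.\<close>
        then have "f x j \<noteq> f x (Suc j)" by auto
        then have "(p, q) \<in> switch_graph t K x"
          using * D[of x y] unfolding switch_path_def by metis
        with * show "y p = Some t \<and> y q = Some (Suc t) \<and> (\<exists>S. switch_simplex t K x p q S)"
          by (auto simp: switch_graph_def)
      qed
    qed (use mem in auto)
  qed (use mem in auto)
  then show ?case by (rule solvable_within_mono) simp_all
next
  case (Suc r)
  let ?R = "sperner_answer (Suc t) v K" and ?m = "r * (L + 2) + ((t + 2) * L + Suc L + 2 * L)"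
  have "solvable_within ?R (L + (?m + 2))
    (\<lambda>x y. D x y \<and> y (f x j) = Some t \<and> y (f x (j + 2 ^ Suc r)) = Some (Suc t))"
  proof (rule solvable_within_query[OF K n, where e = "\<lambda>x. f x (j + 2 ^ r)"])
    show "solvable_within ?R ?m (\<lambda>x y. (D x y \<and> y (f x j) = Some t \<and>
      y (f x (j + 2 ^ Suc r)) = Some (Suc t)) \<and> f x (j + 2 ^ r) = z \<and> y z = Some t)" for z
      by (rule solvable_within_mono[OF Suc.IH[of "j + 2 ^ r"]]) (auto simp: mult_2 add.assoc)
    show "solvable_within ?R ?m (\<lambda>x y. (D x y \<and> y (f x j) = Some t \<and>
      y (f x (j + 2 ^ Suc r)) = Some (Suc t)) \<and> f x (j + 2 ^ r) = z \<and> y z = Some (Suc t))" for z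
      by (rule solvable_within_mono[OF Suc.IH[of j]]) auto
  qed (use D in \<open>auto simp: switch_path_def\<close>)
  then show ?case by (simp add: algebra_simps)
qed

text \<open>One bit tells whether a color of \<open>A\<close> breaks the Sperner condition; if so,
  \<open>A\<close> names the point. Otherwise two queries check the ends of the path, where an
  unexpected answer of \<open>B\<close> gives a violation, and binary search follows.\<close>

lemma solvable_within_sperner:
  fixes v :: "nat \<Rightarrow> 'a::euclidean_space"
  assumes nd: "nondegenerate (Suc t) v" and tri: "triangulates K (big_simplex (Suc t) v)"
    and n: "card (points K) \<le> 2 ^ L"
  shows "solvable_within (sperner_answer (Suc t) v K) (2 * L\<^sup>2 + (t + 11) * L + 6)
    (\<lambda>x y. x \<in> inputs K {..<t} \<and> y \<in> inputs K {t..Suc t})"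
proof -
  \<comment> \<open>The length is a power of two, for halving, and at least the square of the number
    of points, for the existence of the path.\<close>
  let ?R = "sperner_answer (Suc t) v K" and ?N = "2 ^ (2 * L) :: nat"
  let ?I = "\<lambda>x y. x \<in> inputs K {..<t} \<and> y \<in> inputs K {t..Suc t}"
  let ?m = "2 * L * (L + 2) + ((t + 2) * L + Suc L + 2 * L)"
  have K: "simplicial_complex K" using tri by (simp add: triangulates_def)
  have N: "(card (points K))\<^sup>2 \<le> ?N"
    using power_mono[OF n, of 2] by (simp add: mult.commute flip: power_mult)
  define wrong where "wrong x p \<longleftrightarrow> (\<exists>i. x p = Some i \<and> \<not> sperner_at (Suc t) v p i)" for x p
  define f where "f x = (SOME f. switch_path t v K x ?N f)" for x
  define D where "D x y \<longleftrightarrow> ?I x y \<and> \<not> (\<exists>p. wrong x p)" for x y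
  have f: "switch_path t v K x ?N (f x)" if "D x y" for x y
  proof -
    have "\<exists>g. switch_path t v K x ?N g"
      by (rule switch_path_exists[OF nd tri _ _ N]) (use that in \<open>auto simp: D_def wrong_def\<close>)
    then show ?thesis unfolding f_def by (rule someI_ex)
  qed
  have D: "y \<in> inputs K {t..Suc t} \<and> f x i \<in> points K \<and> x (f x i) = None" if "D x y" for x y i
    using that f[OF that] by (simp add: D_def switch_path_def)
  have facet: "?R x y (Violation z)"
    if "x z = None" "y z = Some i" "z \<in> opposite_facet (Suc t) v i" "z \<in> points K" for x y z i
    using that sperner_at_notin_opposite_facet[OF nd] by (auto simp: combine_def)
  have "solvable_within ?R (L + 0) (\<lambda>x y. ?I x y \<and> (\<exists>p. wrong x p))"
  proof (rule solvable_within_announce_A[where e = "\<lambda>x. SOME p. wrong x p", OF finite_points[OF K] n])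
    have *: "wrong x (SOME p. wrong x p)" if "?I x y \<and> (\<exists>p. wrong x p)" for x y
      using that by (metis someI_ex)
    show "(SOME p. wrong x p) \<in> points K" if "?I x y \<and> (\<exists>p. wrong x p)" for x y
      using *[OF that] that by (auto simp: wrong_def inputs_def)
    fix p assume p: "p \<in> points K"
    show "solvable_within ?R 0 (\<lambda>x y. (?I x y \<and> (\<exists>p. wrong x p)) \<and> (SOME p. wrong x p) = p)"
    proof (rule solvable_within_answer[where z = "Violation p"])
      fix x y assume "(?I x y \<and> (\<exists>p. wrong x p)) \<and> (SOME p. wrong x p) = p"
      then obtain i where "x p = Some i" "\<not> sperner_at (Suc t) v p i"
        using * by (metis wrong_def)
      \<comment> \<open>If \<open>B\<close> colors \<open>p\<close> too, then \<open>p\<close> is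
        colored twice, which is also a violation.\<close>
      then show "?R x y (Violation p)"
        using p by (cases "y p") (auto simp: combine_def)
    qed
  qed
  then have "solvable_within ?R (L + (L + (?m + 2) + 2)) (\<lambda>x y. ?I x y \<and> (\<exists>p. wrong x p))"
    by (rule solvable_within_mono) simp_all
  moreover have "solvable_within ?R (L + (L + (?m + 2) + 2)) D"
  proof (rule solvable_within_query[OF K n, where e = "\<lambda>x. f x 0"])
    fix a
    let ?D = "\<lambda>x y. D x y \<and> f x 0 = a \<and> y a = Some t"
    show "solvable_within ?R (L + (?m + 2)) ?D"
    proof (rule solvable_within_query[OF K n, where e = "\<lambda>x. f x ?N"])
      fix b
      show "solvable_within ?R ?m (\<lambda>x y. ?D x y \<and> f x ?N = b \<and> y b = Some (Suc t))"
        by (rule solvable_within_mono[OF solvable_within_binary_search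
              [OF K n, where D = D and f = f and r = "2 * L" and j = 0]]) (use D f in auto)
      show "solvable_within ?R ?m (\<lambda>x y. ?D x y \<and> f x ?N = b \<and> y b = Some t)"
      proof (rule solvable_within_answer[where z = "Violation b"])
        fix x y assume "?D x y \<and> f x ?N = b \<and> y b = Some t"
        then show "?R x y (Violation b)"
          using D[of x y ?N] f[of x y] by (intro facet[of x b y t]) (auto simp: switch_path_def)
      qed
    qed (use D in auto)
    show "solvable_within ?R (L + (?m + 2)) (\<lambda>x y. D x y \<and> f x 0 = a \<and> y a = Some (Suc t))"
    proof (rule solvable_within_answer[where z = "Violation a"])
      fix x y assume "D x y \<and> f x 0 = a \<and> y a = Some (Suc t)"
      then show "?R x y (Violation a)"
        using D[of x y 0] f[of x y] by (intro facet[of x a y "Suc t"]) (auto simp: switch_path_def)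
    qed
  qed (use D in auto)
  ultimately have "solvable_within ?R (Suc (L + (L + (?m + 2) + 2))) ?I"
    unfolding D_def by (rule solvable_within_ask_A)
  then show ?thesis
    by (rule solvable_within_mono) (simp_all add: algebra_simps power2_eq_square)
qed

theorem theorem1p4:
  fixes d :: nat
  assumes "d \<ge> 1"
  shows "\<exists>f :: nat \<Rightarrow> real. f \<in> O(\<lambda>n. (log 2 (real n))\<^sup>2) \<and>
    (\<forall>n>d. \<forall>(v :: nat \<Rightarrow> 'a::euclidean_space) (K :: 'a set set).
       nondegenerate d v \<and> triangulates K (big_simplex d v) \<and> card (points K) = n \<longrightarrow>
       (\<exists>P :: ('a \<rightharpoonup> nat, 'a \<rightharpoonup> nat, 'a answer) protocol.
          solves_Sp (d - 1) d v K P \<and> real (cost P) \<le> f n))"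
proof -
  obtain t where t: "d = Suc t" using assms by (cases d) auto
  \<comment> \<open>The summand 19 makes \<open>t + 19 = 2 + (t + 11) + 6\<close>, the sum of the
    coefficients in the cost; the factor 4 comes from squaring
    \<open>L \<le> 2 * log 2 n\<close>.\<close>
  define f where "f n = 4 * real (t + 19) * (log 2 (real n))\<^sup>2" for n
  have "\<exists>P :: ('a \<rightharpoonup> nat, 'a \<rightharpoonup> nat, 'a answer) protocol.
      solves_Sp (d - 1) d v K P \<and> real (cost P) \<le> f n"
    if n: "n > d" and K: "nondegenerate d v" "triangulates K (big_simplex d v)" "card (points K) = n"
    for n and v :: "nat \<Rightarrow> 'a" and K :: "'a set set"
  proof -
    define L where "L = nat \<lceil>log 2 (real n)\<rceil>"
    \<comment> \<open>As \<open>n \<ge> 2\<close>, rounding the logarithm up at most doubles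
      it.\<close>
    have l: "log 2 (real n) \<ge> 1" using n assms by (simp add: le_log_iff)
    then have L: "1 \<le> L" "real L \<le> 2 * log 2 (real n)" "log 2 (real n) \<le> real L"
      unfolding L_def by linarith+
    from L(3) have "real n \<le> 2 powr real L" using n by (simp add: log_le_iff)
    then have "card (points K) \<le> 2 ^ L"
      unfolding K(3) by (simp add: powr_realpow)
    from solvable_within_sperner[OF K(1,2)[unfolded t] this]
    obtain P :: "('a \<rightharpoonup> nat, 'a \<rightharpoonup> nat, 'a answer) protocol" where
      P: "cost P \<le> 2 * L\<^sup>2 + (t + 11) * L + 6" "solves_Sp (d - 1) d v K P"
      unfolding solvable_within_def solves_Sp_def solves_def t by auto
    have "L \<le> L\<^sup>2" "1 \<le> L\<^sup>2" using L(1) by (simp_all add: power2_eq_square)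
    then have "2 * L\<^sup>2 + (t + 11) * L + 6 \<le> 2 * L\<^sup>2 + (t + 11) * L\<^sup>2 + 6 * L\<^sup>2"
      by (intro add_mono mult_left_mono) auto
    with P(1) have "cost P \<le> (t + 19) * L\<^sup>2" by (simp add: algebra_simps)
    then have "real (cost P) \<le> real (t + 19) * (real L)\<^sup>2" by (metis of_nat_le_iff of_nat_mult of_nat_power)
    also have "\<dots> \<le> real (t + 19) * (2 * log 2 (real n))\<^sup>2"
      using L by (intro mult_left_mono power_mono) auto
    also have "\<dots> = f n" by (simp add: f_def power_mult_distrib)
    finally show ?thesis using P(2) by blast
  qed
  moreover have "f \<in> O(\<lambda>n. (log 2 (real n))\<^sup>2)" unfolding f_def by simp
  ultimately show ?thesis by blast
qed

end
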